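(* Let $A,B,C$ be Hermitian positive semidefinite complex matrices of the same size. Then for each integer $p\geqslant 1$, in the Löwner order, $$(A+B+C)^{\otimes p} + A^{\otimes p} + B^{\otimes p} + C^{\otimes p} \ \geqslant\ (A+B)^{\otimes p} + (A+C)^{\otimes p} + (B+C)^{\otimes p}.$$
   Context: For a matrix $A$, $A^{\otimes p}=A\otimes\cdots\otimes A$ ($p$ factors) is the Kronecker (tensor) power. For Hermitian $X,Y$ of the same size, $X\geqslant Y$ (Löwner order) means that $X-Y$ is positive semidefinite. *)

theory Defs
  imports "Jordan_Normal_Form.Schur_Decomposition"
begin

definition hermitian_mat :: "complex mat \<Rightarrow> bool" where
  "hermitian_mat A \<longleftrightarrow> mat_adjoint A = A"

lemma hermitian_mat_iff:
  "hermitian_mat A \<longleftrightarrow> dim_row A = dim_col A \<and>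
     (\<forall>i < dim_row A. \<forall>j < dim_col A. A $$ (i, j) = cnj (A $$ (j, i)))"
proof -
  have "dim_row (mat_adjoint A) = dim_col A" "dim_col (mat_adjoint A) = dim_row A"
    by (simp_all add: mat_adjoint_def)
  moreover have "mat_adjoint A $$ (i, j) = cnj (A $$ (j, i))"
    if "i < dim_col A" "j < dim_row A" for i j
    using that by (simp add: mat_adjoint_def mat_of_rows_index)
  ultimately show ?thesis
    unfolding hermitian_mat_def mat_eq_iff by (metis (no_types, lifting))
qed

text \<open>Here \<open>0 \<le> z\<close> is the library order on complex numbers: \<open>z\<close> is real and nonnegative.
  The scalar \<open>(A *\<^sub>v v) \<bullet>c v\<close> is \<open>v\<^sup>* A v\<close>.\<close>

definition psd_mat :: "complex mat \<Rightarrow> bool" where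
  "psd_mat A \<longleftrightarrow> hermitian_mat A \<and>
     (\<forall>v \<in> carrier_vec (dim_row A). 0 \<le> (A *\<^sub>v v) \<bullet>c v)"

text \<open>The order is only defined between Hermitian matrices of the same size, so both conditions
  are part of the relation. The size condition is needed because subtraction in the matrix library
  is total and takes the dimensions of its second argument.\<close>

definition loewner_ge :: "complex mat \<Rightarrow> complex mat \<Rightarrow> bool" (infix \<open>\<ge>\<^sub>L\<close> 50) where
  "X \<ge>\<^sub>L Y \<longleftrightarrow> hermitian_mat X \<and> hermitian_mat Y \<and> dim_row X = dim_row Y \<and> psd_mat (X - Y)"

definition kronecker :: "complex mat \<Rightarrow> complex mat \<Rightarrow> complex mat" (infixr \<open>\<otimes>\<^sub>K\<close> 70) where
  "A \<otimes>\<^sub>K B = mat (dim_row A * dim_row B) (dim_col A * dim_col B)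
     (\<lambda>(i, j). A $$ (i div dim_row B, j div dim_col B) * B $$ (i mod dim_row B, j mod dim_col B))"

text \<open>The empty Kronecker product is the \<open>1 \<times> 1\<close> identity matrix, so that
  \<open>p \<ge> 1\<close> gives \<open>A \<otimes> \<dots> \<otimes> A\<close> with \<open>p\<close> factors.\<close>

fun kronecker_power :: "complex mat \<Rightarrow> nat \<Rightarrow> complex mat" (infixr \<open>^\<^sub>K\<close> 80) where
  "A ^\<^sub>K 0 = 1\<^sub>m 1"
| "A ^\<^sub>K Suc p = A \<otimes>\<^sub>K (A ^\<^sub>K p)"

lemma kronecker_power_one: "A ^\<^sub>K 1 = A"
  by (rule eq_matI) (simp_all add: kronecker_def)

end

theory Submission
  imports Defs
begin

text \<open>The inequality says that a third-order finite difference of the map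
  \<open>X \<mapsto> X ^\<^sub>K p\<close> at \<open>0\<close> in the directions \<open>A\<close>, \<open>B\<close>, \<open>C\<close> is positive semidefinite:
  the missing term is the power of \<open>0\<close>, which vanishes for \<open>p \<ge> 1\<close>. It rests on a Leibniz rule. In \<open>(A + B + C) ^\<^sub>K Suc q = (A + B + C) \<otimes>\<^sub>K (A + B + C) ^\<^sub>K q\<close>,
  and likewise for the other six powers, expand the first factor and collect the terms that have
  \<open>A\<close>, \<open>B\<close> or \<open>C\<close> there. What multiplies \<open>A\<close> is
  \<open>(A + B + C) ^\<^sub>K q + A ^\<^sub>K q - (A + B) ^\<^sub>K q - (A + C) ^\<^sub>K q\<close>,
  the second difference at base point \<open>A\<close> in the directions \<open>B\<close> and \<open>C\<close>.
  The same expansion writes a second difference of order \<open>Suc q\<close> through one second difference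
  and two first differences of order \<open>q\<close> (lemma \<open>kronecker_power_second_diff_psd\<close>), and a first
  difference through a first difference and a power (lemma \<open>kronecker_power_diff_psd\<close>).
  All coefficients in these expansions are \<open>+1\<close>, so everything is positive semidefinite by
  induction, once sums and Kronecker products of positive semidefinite matrices are known to be
  so.

  For Kronecker products (lemma \<open>psd_mat_kronecker\<close>), write the left factor as a sum of rank-one
  matrices \<open>w w\<^sup>*\<close>. The quadratic form of \<open>w w\<^sup>* \<otimes>\<^sub>K B\<close> at a vector is the quadratic form of
  \<open>B\<close> at the contraction of that vector with \<open>w\<close>, hence nonnegative. The rank-one
  decomposition comes from Cholesky elimination (lemma \<open>psd_kernel_gram\<close>): splitting off the last
  row and column leaves a Schur complement, which is again positive semidefinite.\<close>

section \<open>Positive semidefinite kernels and their rank-one decomposition\<close>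

text \<open>Indexing by functions on \<open>nat\<close> lets the elimination pass from size \<open>Suc n\<close> to \<open>n\<close> by forgetting
  the last index, without any block matrices; the vector \<open>x\<close> likewise needs no length.\<close>

definition psd_kernel :: "nat \<Rightarrow> (nat \<Rightarrow> nat \<Rightarrow> complex) \<Rightarrow> bool" where
  "psd_kernel n a \<longleftrightarrow> (\<forall>i<n. \<forall>j<n. a i j = cnj (a j i)) \<and>
     (\<forall>x. 0 \<le> (\<Sum>i<n. \<Sum>j<n. a i j * x j * cnj (x i)))"

lemma psd_mat_iff_kernel:
  assumes M: "M \<in> carrier_mat n n"
  shows "psd_mat M \<longleftrightarrow> psd_kernel n (\<lambda>i j. M $$ (i, j))"
proof -
  have form: "(M *\<^sub>v v) \<bullet>c v = (\<Sum>i<n. \<Sum>j<n. M $$ (i, j) * v $ j * cnj (v $ i))"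
    if "v \<in> carrier_vec n" for v
    using that M
    by (auto simp: scalar_prod_def mult_mat_vec_def atLeast0LessThan sum_distrib_right
        conjugate_complex_def intro!: sum.cong)
  have "(\<forall>v \<in> carrier_vec n. 0 \<le> (M *\<^sub>v v) \<bullet>c v) \<longleftrightarrow>
     (\<forall>x. 0 \<le> (\<Sum>i<n. \<Sum>j<n. M $$ (i, j) * x j * cnj (x i)))" (is "?L \<longleftrightarrow> ?R")
  proof
    assume L: ?L
    show ?R
    proof
      fix x :: "nat \<Rightarrow> complex"
      have "0 \<le> (M *\<^sub>v vec n x) \<bullet>c vec n x" using L by simp
      then show "0 \<le> (\<Sum>i<n. \<Sum>j<n. M $$ (i, j) * x j * cnj (x i))"
        by (simp add: form)
    qed
  qed (simp add: form)
  then show ?thesis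
    using M unfolding psd_mat_def psd_kernel_def hermitian_mat_iff by auto
qed

lemma psd_kernel_hermitian:
  "psd_kernel n a \<Longrightarrow> i < n \<Longrightarrow> j < n \<Longrightarrow> cnj (a j i) = a i j"
  unfolding psd_kernel_def by metis

text \<open>The quadratic form in \<open>n + 1\<close> variables, seen as a quadratic polynomial in its last variable
  \<open>t\<close>. Choosing \<open>t\<close> well is what drives both uses of positivity in the elimination step.\<close>

lemma bordered_form:
  fixes a :: "nat \<Rightarrow> nat \<Rightarrow> complex"
  assumes herm: "\<And>i. i < n \<Longrightarrow> cnj (a n i) = a i n"
  defines "s x \<equiv> \<Sum>j<n. a n j * x j"
  shows "(\<Sum>i<Suc n. \<Sum>j<Suc n. a i j * (x(n := t)) j * cnj ((x(n := t)) i)) =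
    (\<Sum>i<n. \<Sum>j<n. a i j * x j * cnj (x i)) + t * cnj (s x) + cnj t * s x + a n n * t * cnj t"
proof -
  have "t * cnj (s x) = (\<Sum>i<n. a i n * t * cnj (x i))"
    by (auto simp: s_def sum_distrib_left herm intro!: sum.cong)
  moreover have "cnj t * s x = (\<Sum>j<n. a n j * x j * cnj t)"
    by (auto simp: s_def sum_distrib_left intro!: sum.cong)
  ultimately show ?thesis
    by (simp add: sum.distrib)
qed

lemma form_unit_vector:
  fixes a :: "nat \<Rightarrow> nat \<Rightarrow> complex"
  assumes k: "k < n"
  defines "e \<equiv> \<lambda>i. if i = k then 1 else 0"
  shows "(\<Sum>i<n. \<Sum>j<n. a i j * e j * cnj (e i)) = a k k"
proof -
  have "(\<Sum>j<n. a i j * e j * cnj (e i)) = (if i = k then a k k else 0)" for i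
    using k by (simp add: e_def if_distrib[where f="\<lambda>x. _ * x"] cong: if_cong)
  then show ?thesis using k by simp
qed

text \<open>If the pivot vanishes, then the form at the unit vector \<open>i\<close> plus \<open>t\<close> times the unit vector \<open>n\<close>
  is real-affine in \<open>t\<close>, so it could be made negative if it depended on \<open>t\<close> at all.\<close>

lemma psd_kernel_zero_pivot:
  assumes psd: "psd_kernel (Suc n) a" and pivot: "a n n = 0" and i: "i < n"
  shows "a n i = 0"
proof (rule ccontr)
  define z where "z = a n i"
  assume "a n i \<noteq> 0"
  then have z: "(cmod z)\<^sup>2 > 0" by (simp add: z_def)
  define e :: "nat \<Rightarrow> complex" where "e = (\<lambda>j. if j = i then 1 else 0)"
  have herm: "cnj (a n k) = a k n" if "k < n" for k
    using psd_kernel_hermitian[OF psd, of k n] that by simp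
  have Q: "(\<Sum>k<n. \<Sum>j<n. a k j * e j * cnj (e k)) = a i i"
    unfolding e_def using i by (rule form_unit_vector)
  have s: "(\<Sum>j<n. a n j * e j) = z"
    using i by (simp add: e_def z_def if_distrib[where f="\<lambda>x. _ * x"] cong: if_cong)
  \<comment> \<open>The scale \<open>r\<close> is chosen so that the form takes the value \<open>-1\<close>, up to the imaginary part of \<open>a i i\<close>.\<close>
  define r where "r = (Re (a i i) + 1) / (2 * (cmod z)\<^sup>2)"
  define t where "t = - of_real r * z"
  have "0 \<le> (\<Sum>i<Suc n. \<Sum>j<Suc n. a i j * (e(n := t)) j * cnj ((e(n := t)) i))"
    using psd unfolding psd_kernel_def by blast
  also have "\<dots> = a i i + t * cnj z + cnj t * z"
    using bordered_form[of n a e t, OF herm] unfolding Q s pivot by simp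
  also have "\<dots> = a i i - of_real (2 * r * (cmod z)\<^sup>2)"
  proof -
    have "(complex_of_real (cmod z))\<^sup>2 = z * cnj z"
      by (metis complex_norm_square of_real_power)
    then show ?thesis by (simp add: t_def algebra_simps)
  qed
  also have "2 * r * (cmod z)\<^sup>2 = Re (a i i) + 1"
    using z by (simp add: r_def)
  finally show False by (simp add: less_eq_complex_def)
qed

text \<open>The value of the Schur complement at \<open>x\<close> is the minimum over \<open>t\<close> of the original form at
  \<open>x\<close> extended by \<open>t\<close>. For a zero pivot, division by zero yields \<open>0\<close>, so the statement then speaks
  of the leading block of \<open>a\<close>; the minimising \<open>t = - s / a n n\<close> becomes \<open>0\<close>, which fits.\<close>

lemma psd_kernel_schur_complement:
  assumes psd: "psd_kernel (Suc n) a"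
  shows "psd_kernel n (\<lambda>i j. a i j - a i n * a n j / a n n)"
proof -
  note herm = psd_kernel_hermitian[OF psd]
  have border: "cnj (a n i) = a i n" if "i < n" for i
    using herm[of i n] that by simp
  have real: "cnj (a n n) = a n n" using herm[of n n] by simp
  show ?thesis
    unfolding psd_kernel_def
  proof (intro conjI allI impI)
    fix i j assume "i < n" "j < n"
    then show "a i j - a i n * a n j / a n n = cnj (a j i - a j n * a n i / a n n)"
      using herm[of i j] herm[of i n] herm[of n j] by (simp add: real mult.commute)
  next
    fix x :: "nat \<Rightarrow> complex"
    define s where "s = (\<Sum>j<n. a n j * x j)"
    define t where "t = - s / a n n"
    have cs: "cnj s = (\<Sum>i<n. a i n * cnj (x i))"
      by (auto simp: s_def border intro!: sum.cong)
    have "(\<Sum>i<n. \<Sum>j<n. (a i j - a i n * a n j / a n n) * x j * cnj (x i))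
        = (\<Sum>i<n. \<Sum>j<n. a i j * x j * cnj (x i)) - cnj s * s / a n n"
      unfolding cs unfolding s_def sum_product sum_divide_distrib sum_subtractf[symmetric]
      by (auto simp: algebra_simps intro!: sum.cong)
    also have "\<dots> = (\<Sum>i<n. \<Sum>j<n. a i j * x j * cnj (x i)) + t * cnj s + cnj t * s
        + a n n * t * cnj t"
      by (cases "a n n = 0") (simp_all add: t_def real field_simps)
    also have "\<dots> = (\<Sum>i<Suc n. \<Sum>j<Suc n. a i j * (x(n := t)) j * cnj ((x(n := t)) i))"
      unfolding s_def by (rule bordered_form[of n a, OF border, symmetric])
    also have "0 \<le> \<dots>"
      using psd unfolding psd_kernel_def by blast
    finally show "0 \<le> (\<Sum>i<n. \<Sum>j<n. (a i j - a i n * a n j / a n n) * x j * cnj (x i))" .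
  qed
qed

lemma psd_kernel_diagonal_nonneg:
  assumes psd: "psd_kernel n a" and k: "k < n"
  shows "0 \<le> a k k"
proof -
  define e :: "nat \<Rightarrow> complex" where "e = (\<lambda>j. if j = k then 1 else 0)"
  have "0 \<le> (\<Sum>i<n. \<Sum>j<n. a i j * e j * cnj (e i))"
    using psd unfolding psd_kernel_def by blast
  also have "\<dots> = a k k"
    unfolding e_def using k by (rule form_unit_vector)
  finally show ?thesis .
qed

text \<open>Cholesky elimination: the last vector is the pivot column divided by the square root of the
  pivot, and the others decompose the Schur complement. When the pivot is zero, that last vector
  is \<open>0\<close> by the convention on division, and the last row and column are zero as well.\<close>

lemma psd_kernel_gram:
  assumes "psd_kernel n a"
  shows "\<exists>w. \<forall>i<n. \<forall>j<n. a i j = (\<Sum>k<n. w k i * cnj (w k j))"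
  using assms
proof (induction n arbitrary: a)
  case 0
  then show ?case by simp
next
  case (Suc n)
  from Suc.IH[OF psd_kernel_schur_complement[OF Suc.prems]] obtain w where
    w: "a i j - a i n * a n j / a n n = (\<Sum>k<n. w k i * cnj (w k j))" if "i < n" "j < n" for i j
    by blast
  note herm = psd_kernel_hermitian[OF Suc.prems]
  define d where "d = Re (a n n)"
  have d: "a n n = of_real d" "d \<ge> 0"
    using psd_kernel_diagonal_nonneg[OF Suc.prems, of n]
    by (auto simp: d_def less_eq_complex_def complex_eq_iff)
  have rr: "complex_of_real (sqrt d) * complex_of_real (sqrt d) = a n n"
    using d by (metis of_real_mult real_sqrt_mult_self abs_of_nonneg)
  have zero: "a n i = 0" if "a n n = 0" "i < n" for i
    using psd_kernel_zero_pivot[OF Suc.prems] that by blast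
  define u where "u i = a i n / of_real (sqrt d)" for i
  define w' where "w' k i = (if k = n then u i else if i = n then 0 else w k i)" for k i
  have uu: "u i * cnj (u j) = a i n * a n j / a n n" if "i < Suc n" "j < Suc n" for i j
    using herm[of n j] that by (simp add: u_def rr)
  have "a i j = (\<Sum>k<Suc n. w' k i * cnj (w' k j))" if ij: "i < Suc n" "j < Suc n" for i j
  proof -
    have *: "(\<Sum>k<n. w' k i * cnj (w' k j)) =
        (if i = n \<or> j = n then 0 else \<Sum>k<n. w k i * cnj (w k j))"
      by (auto simp: w'_def intro!: sum.neutral sum.cong)
    have "(\<Sum>k<Suc n. w' k i * cnj (w' k j)) =
        (if i = n \<or> j = n then 0 else a i j - a i n * a n j / a n n) + a i n * a n j / a n n"
      using ij w[of i j] by (simp add: * uu[symmetric]) (simp add: w'_def)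
    also have "\<dots> = a i j"
    proof (cases "i = n \<or> j = n")
      case True
      then show ?thesis
        using zero[of j] zero[of i] herm[of i n] ij by (cases "a n n = 0") (auto simp: less_Suc_eq)
    qed simp
    finally show ?thesis by simp
  qed
  then show ?case by blast
qed

section \<open>Closure of the positive semidefinite matrices under sums and Kronecker products\<close>

lemma sum_lessThan_mult:
  fixes f :: "nat \<Rightarrow> 'a::comm_monoid_add"
  shows "(\<Sum>i<n * m. f i) = (\<Sum>i<n. \<Sum>r<m. f (i * m + r))"
proof -
  have "(\<Sum>r<m. f (i * m + r)) = sum f {i * m..<i * m + m}" for i
    using sum.shift_bounds_nat_ivl[of f 0 "i * m" m] by (simp add: atLeast0LessThan add.commute)
  then show ?thesis by (simp add: sum.nat_group)
qed

lemma kronecker_carrier [simp]: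
  "A \<in> carrier_mat m n \<Longrightarrow> B \<in> carrier_mat k l \<Longrightarrow> A \<otimes>\<^sub>K B \<in> carrier_mat (m * k) (n * l)"
  by (simp add: kronecker_def)

lemma kronecker_index:
  assumes "A \<in> carrier_mat n n" "B \<in> carrier_mat m m" "i < n * m" "j < n * m"
  shows "(A \<otimes>\<^sub>K B) $$ (i, j) = A $$ (i div m, j div m) * B $$ (i mod m, j mod m)"
  using assms by (simp add: kronecker_def)

lemma div_mod_less_mult:
  assumes "i < n * (m::nat)"
  shows "i div m < n" "i mod m < m"
  using assms by (auto simp: less_mult_imp_div_less) (metis mod_less_divisor mult_0_right not_gr_zero not_less_zero)

text \<open>With \<open>A = (\<Sum>k. w k (w k)\<^sup>*)\<close> the form of \<open>A \<otimes>\<^sub>K B\<close> at \<open>x\<close> becomes a sum over \<open>k\<close> of the form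
  of \<open>B\<close> at \<open>y k\<close>, the contraction of the first tensor index of \<open>x\<close> with \<open>w k\<close>.\<close>

lemma psd_mat_kronecker:
  assumes A: "A \<in> carrier_mat n n" and B: "B \<in> carrier_mat m m"
    and psdA: "psd_mat A" and psdB: "psd_mat B"
  shows "psd_mat (A \<otimes>\<^sub>K B)"
proof -
  let ?a = "\<lambda>i j. A $$ (i, j)" and ?b = "\<lambda>i j. B $$ (i, j)"
  have a: "psd_kernel n ?a" and b: "psd_kernel m ?b"
    using psdA psdB A B by (simp_all add: psd_mat_iff_kernel)
  obtain w where w: "A $$ (i, j) = (\<Sum>k<n. w k i * cnj (w k j))" if "i < n" "j < n" for i j
    using psd_kernel_gram[OF a] by blast
  have idx: "i * m + r < n * m" if "i < n" "r < m" for i r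
  proof -
    have "i * m + r < Suc i * m" using that by simp
    also have "\<dots> \<le> n * m" using that by (intro mult_le_mono1) simp
    finally show ?thesis .
  qed
  have "psd_kernel (n * m) (\<lambda>i j. (A \<otimes>\<^sub>K B) $$ (i, j))"
    unfolding psd_kernel_def
  proof (intro conjI allI impI)
    fix i j assume ij: "i < n * m" "j < n * m"
    show "(A \<otimes>\<^sub>K B) $$ (i, j) = cnj ((A \<otimes>\<^sub>K B) $$ (j, i))"
      using ij div_mod_less_mult[OF ij(1)] div_mod_less_mult[OF ij(2)]
      by (simp add: kronecker_index[OF A B] psd_kernel_hermitian[OF a] psd_kernel_hermitian[OF b])
  next
    fix x :: "nat \<Rightarrow> complex"
    define y where "y k r = (\<Sum>i<n. cnj (w k i) * x (i * m + r))" for k r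
    have "(\<Sum>i<n * m. \<Sum>j<n * m. (A \<otimes>\<^sub>K B) $$ (i, j) * x j * cnj (x i)) =
      (\<Sum>i<n. \<Sum>r<m. \<Sum>j<n. \<Sum>s<m. A $$ (i, j) * B $$ (r, s) * x (j * m + s) * cnj (x (i * m + r)))"
      unfolding sum_lessThan_mult
      by (intro sum.cong refl) (simp add: kronecker_index[OF A B] idx)
    also have "\<dots> = (\<Sum>i<n. \<Sum>r<m. \<Sum>j<n. \<Sum>s<m. \<Sum>k<n.
        (w k i * cnj (w k j)) * B $$ (r, s) * x (j * m + s) * cnj (x (i * m + r)))"
      by (intro sum.cong refl) (simp add: w sum_distrib_right)
    also have "\<dots> = (\<Sum>k<n. \<Sum>r<m. \<Sum>s<m. \<Sum>i<n. \<Sum>j<n.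
        (w k i * cnj (w k j)) * B $$ (r, s) * x (j * m + s) * cnj (x (i * m + r)))"
      unfolding sum.cartesian_product
      by (rule sum.reindex_bij_witness[of _ "\<lambda>(k, r, s, i, j). (i, r, j, s, k)"
            "\<lambda>(i, r, j, s, k). (k, r, s, i, j)"]) auto
    also have "\<dots> = (\<Sum>k<n. \<Sum>r<m. \<Sum>s<m. B $$ (r, s) * y k s * cnj (y k r))"
    proof (intro sum.cong refl)
      fix k r s
      have "cnj (y k r) * y k s =
          (\<Sum>i<n. \<Sum>j<n. (w k i * cnj (x (i * m + r))) * (cnj (w k j) * x (j * m + s)))"
        by (simp add: y_def sum_product)
      then have "B $$ (r, s) * y k s * cnj (y k r) = B $$ (r, s) *
          (\<Sum>i<n. \<Sum>j<n. (w k i * cnj (x (i * m + r))) * (cnj (w k j) * x (j * m + s)))"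
        by (simp add: mult.assoc mult.commute[of "y k s"])
      then show "(\<Sum>i<n. \<Sum>j<n. (w k i * cnj (w k j)) * B $$ (r, s) * x (j * m + s) * cnj (x (i * m + r)))
          = B $$ (r, s) * y k s * cnj (y k r)"
        by (simp add: sum_distrib_left mult_ac)
    qed
    also have "0 \<le> \<dots>"
    proof (rule sum_nonneg)
      fix k
      show "0 \<le> (\<Sum>r<m. \<Sum>s<m. B $$ (r, s) * y k s * cnj (y k r))"
        using b unfolding psd_kernel_def by blast
    qed
    finally show "0 \<le> (\<Sum>i<n * m. \<Sum>j<n * m. (A \<otimes>\<^sub>K B) $$ (i, j) * x j * cnj (x i))" .
  qed
  then show ?thesis
    using A B by (simp add: psd_mat_iff_kernel[of _ "n * m"])
qed

lemma psd_mat_add: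
  assumes A: "A \<in> carrier_mat n n" and B: "B \<in> carrier_mat n n"
    and "psd_mat A" "psd_mat B"
  shows "psd_mat (A + B)"
proof -
  have ab: "psd_kernel n (\<lambda>i j. A $$ (i, j))" "psd_kernel n (\<lambda>i j. B $$ (i, j))"
    using assms by (simp_all add: psd_mat_iff_kernel)
  have "psd_kernel n (\<lambda>i j. (A + B) $$ (i, j))"
    unfolding psd_kernel_def
  proof (intro conjI allI impI)
    fix i j assume "i < n" "j < n"
    then show "(A + B) $$ (i, j) = cnj ((A + B) $$ (j, i))"
      using A B by (simp add: psd_kernel_hermitian[OF ab(1)] psd_kernel_hermitian[OF ab(2)])
  next
    fix x :: "nat \<Rightarrow> complex"
    have "(\<Sum>i<n. \<Sum>j<n. (A + B) $$ (i, j) * x j * cnj (x i)) =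
      (\<Sum>i<n. \<Sum>j<n. A $$ (i, j) * x j * cnj (x i)) + (\<Sum>i<n. \<Sum>j<n. B $$ (i, j) * x j * cnj (x i))"
      unfolding sum.distrib[symmetric] using A B by (intro sum.cong refl) (simp add: distrib_right)
    also have "0 \<le> \<dots>"
      using ab unfolding psd_kernel_def by (intro add_nonneg_nonneg) blast+
    finally show "0 \<le> (\<Sum>i<n. \<Sum>j<n. (A + B) $$ (i, j) * x j * cnj (x i))" .
  qed
  then show ?thesis
    using A B by (simp add: psd_mat_iff_kernel[of _ n])
qed

lemma kronecker_power_carrier [simp]:
  "A \<in> carrier_mat n n \<Longrightarrow> A ^\<^sub>K p \<in> carrier_mat (n ^ p) (n ^ p)"
  by (induction p) simp_all

lemma psd_mat_zero: "psd_mat (0\<^sub>m n n)"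
  by (subst psd_mat_iff_kernel[of _ n]) (auto simp: psd_kernel_def)

lemma psd_mat_one: "psd_mat (1\<^sub>m 1)"
proof -
  have "0 \<le> x * cnj x" for x :: complex
    by (simp add: less_eq_complex_def)
  then show ?thesis
    by (subst psd_mat_iff_kernel[of _ 1]) (auto simp: psd_kernel_def)
qed

lemma psd_mat_kronecker_power:
  assumes "A \<in> carrier_mat n n" "psd_mat A"
  shows "psd_mat (A ^\<^sub>K p)"
proof (induction p)
  case 0
  then show ?case using psd_mat_one by simp
next
  case (Suc p)
  then show ?case
    using psd_mat_kronecker[OF assms(1) kronecker_power_carrier[OF assms(1)] assms(2)] by simp
qed

section \<open>Finite differences of the Kronecker power\<close>

text \<open>The step is the Leibniz rule
  \<open>(T + H) \<otimes>\<^sub>K X - T \<otimes>\<^sub>K Y = T \<otimes>\<^sub>K (X - Y) + H \<otimes>\<^sub>K X\<close>, where \<open>X\<close> and \<open>Y\<close> are the \<open>p\<close>-th powers of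
  \<open>T + H\<close> and \<open>T\<close>. For \<open>p = 0\<close> the difference is the zero matrix.\<close>

lemma kronecker_power_diff_psd:
  assumes T: "T \<in> carrier_mat n n" "psd_mat T" and H: "H \<in> carrier_mat n n" "psd_mat H"
  shows "psd_mat ((T + H) ^\<^sub>K p - T ^\<^sub>K p)"
proof (induction p)
  case 0
  have "1\<^sub>m 1 - 1\<^sub>m 1 = (0\<^sub>m 1 1 :: complex mat)"
    by (intro eq_matI) auto
  then show ?case using psd_mat_zero[of 1] by (simp only: kronecker_power.simps)
next
  case (Suc p)
  define X Y where "X = (T + H) ^\<^sub>K p" and "Y = T ^\<^sub>K p"
  define N where "N = n ^ p"
  have XY: "X \<in> carrier_mat N N" "Y \<in> carrier_mat N N"
    using T H by (auto simp: X_def Y_def N_def)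
  have "(T + H) \<otimes>\<^sub>K X - T \<otimes>\<^sub>K Y = T \<otimes>\<^sub>K (X - Y) + H \<otimes>\<^sub>K X"
    using T H XY by (intro eq_matI) (auto simp: kronecker_def div_mod_less_mult algebra_simps)
  moreover have "psd_mat (T \<otimes>\<^sub>K (X - Y) + H \<otimes>\<^sub>K X)"
    using T H XY Suc.IH psd_mat_kronecker_power[OF _ psd_mat_add[OF T(1) H(1) T(2) H(2)], of n p]
    by (intro psd_mat_add[of _ "n * N"] psd_mat_kronecker[of _ n _ N]
        add_carrier_mat kronecker_carrier minus_carrier_mat)
       (auto simp: X_def Y_def)
  ultimately show ?case by (simp add: X_def Y_def)
qed

text \<open>Expanding the first tensor factor, \<open>A\<close> is multiplied by the second difference of the lower
  power, while \<open>B\<close> and \<open>C\<close> are multiplied by first differences, at base points \<open>A + B\<close> and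
  \<open>A + C\<close> respectively.\<close>

lemma kronecker_power_second_diff_psd:
  assumes A: "A \<in> carrier_mat n n" "psd_mat A" and B: "B \<in> carrier_mat n n" "psd_mat B"
    and C: "C \<in> carrier_mat n n" "psd_mat C"
  shows "psd_mat ((A + B + C) ^\<^sub>K p + A ^\<^sub>K p - ((A + B) ^\<^sub>K p + (A + C) ^\<^sub>K p))"
proof (induction p)
  case 0
  have "1\<^sub>m 1 + 1\<^sub>m 1 - (1\<^sub>m 1 + 1\<^sub>m 1) = (0\<^sub>m 1 1 :: complex mat)"
    by (intro eq_matI) auto
  then show ?case using psd_mat_zero[of 1] by (simp only: kronecker_power.simps)
next
  case (Suc p)
  define S P Q R where "S = (A + B + C) ^\<^sub>K p" and "P = (A + B) ^\<^sub>K p"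
    and "Q = (A + C) ^\<^sub>K p" and "R = A ^\<^sub>K p"
  define N where "N = n ^ p"
  have carr: "S \<in> carrier_mat N N" "P \<in> carrier_mat N N" "Q \<in> carrier_mat N N" "R \<in> carrier_mat N N"
    using A B C by (auto simp: S_def P_def Q_def R_def N_def)
  have SP: "psd_mat (S - P)"
    using kronecker_power_diff_psd[of "A + B" n C p] A B C psd_mat_add[of A n B]
    by (auto simp: S_def P_def)
  have "A + B + C = A + C + B"
    using A B C by (intro eq_matI) auto
  then have SQ: "psd_mat (S - Q)"
    using kronecker_power_diff_psd[of "A + C" n B p] A B C psd_mat_add[of A n C]
    by (auto simp: S_def Q_def)
  have "(A + B + C) \<otimes>\<^sub>K S + A \<otimes>\<^sub>K R - ((A + B) \<otimes>\<^sub>K P + (A + C) \<otimes>\<^sub>K Q) =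
     A \<otimes>\<^sub>K (S + R - (P + Q)) + B \<otimes>\<^sub>K (S - P) + C \<otimes>\<^sub>K (S - Q)"
    using A B C carr by (intro eq_matI) (auto simp: kronecker_def div_mod_less_mult algebra_simps)
  moreover have "psd_mat (A \<otimes>\<^sub>K (S + R - (P + Q)) + B \<otimes>\<^sub>K (S - P) + C \<otimes>\<^sub>K (S - Q))"
    using A B C carr SP SQ Suc.IH
    by (intro psd_mat_add[of _ "n * N"] psd_mat_kronecker[of _ n _ N]
        add_carrier_mat kronecker_carrier minus_carrier_mat)
       (auto simp: S_def P_def Q_def R_def)
  ultimately show ?case by (simp add: S_def P_def Q_def R_def)
qed

theorem theorem2p1:
  fixes A B C :: "complex mat" and n p :: nat
  assumes "A \<in> carrier_mat n n" and "B \<in> carrier_mat n n" and "C \<in> carrier_mat n n"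
    and "psd_mat A" and "psd_mat B" and "psd_mat C"
    and "p \<ge> 1"
  shows "(A + B + C) ^\<^sub>K p + A ^\<^sub>K p + B ^\<^sub>K p + C ^\<^sub>K p
           \<ge>\<^sub>L (A + B) ^\<^sub>K p + (A + C) ^\<^sub>K p + (B + C) ^\<^sub>K p"
proof -
  note A = assms(1) assms(4) and B = assms(2) assms(5) and C = assms(3) assms(6)
  obtain q where p: "p = Suc q"
    using \<open>p \<ge> 1\<close> by (cases p) auto
  define S P Q R where "S = (A + B + C) ^\<^sub>K q" and "P = (A + B) ^\<^sub>K q"
    and "Q = (A + C) ^\<^sub>K q" and "R = (B + C) ^\<^sub>K q"
  define X Y Z where "X = A ^\<^sub>K q" and "Y = B ^\<^sub>K q" and "Z = C ^\<^sub>K q"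
  define N where "N = n ^ q"
  have carr: "S \<in> carrier_mat N N" "P \<in> carrier_mat N N" "Q \<in> carrier_mat N N" "R \<in> carrier_mat N N"
    "X \<in> carrier_mat N N" "Y \<in> carrier_mat N N" "Z \<in> carrier_mat N N"
    using A B C by (auto simp: S_def P_def Q_def R_def X_def Y_def Z_def N_def)
  have perm: "B + A = A + B" "C + A = A + C" "C + B = B + C"
    "B + C + A = A + B + C" "A + C + B = A + B + C"
    using A B C by (auto intro!: eq_matI)
  have EA: "psd_mat (S + X - (P + Q))"
    using kronecker_power_second_diff_psd[OF A B C, of q]
    by (simp add: S_def P_def Q_def X_def)
  have EB: "psd_mat (S + Y - (R + P))"
    using kronecker_power_second_diff_psd[OF B C A, of q]
    by (simp add: S_def P_def R_def Y_def perm)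
  have EC: "psd_mat (S + Z - (Q + R))"
    using kronecker_power_second_diff_psd[OF C A B, of q]
    by (simp add: S_def Q_def R_def Z_def perm)
  have "(A + B + C) \<otimes>\<^sub>K S + A \<otimes>\<^sub>K X + B \<otimes>\<^sub>K Y + C \<otimes>\<^sub>K Z
       - ((A + B) \<otimes>\<^sub>K P + (A + C) \<otimes>\<^sub>K Q + (B + C) \<otimes>\<^sub>K R) =
     A \<otimes>\<^sub>K (S + X - (P + Q)) + B \<otimes>\<^sub>K (S + Y - (R + P)) + C \<otimes>\<^sub>K (S + Z - (Q + R))"
    using A B C carr by (intro eq_matI) (auto simp: kronecker_def div_mod_less_mult algebra_simps)
  moreover have "psd_mat (A \<otimes>\<^sub>K (S + X - (P + Q)) + B \<otimes>\<^sub>K (S + Y - (R + P)) + C \<otimes>\<^sub>K (S + Z - (Q + R)))"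
    using A B C carr EA EB EC
    by (intro psd_mat_add[of _ "n * N"] psd_mat_kronecker[of _ n _ N]
        add_carrier_mat kronecker_carrier minus_carrier_mat) auto
  ultimately have diff: "psd_mat ((A + B + C) ^\<^sub>K p + A ^\<^sub>K p + B ^\<^sub>K p + C ^\<^sub>K p
       - ((A + B) ^\<^sub>K p + (A + C) ^\<^sub>K p + (B + C) ^\<^sub>K p))"
    by (simp add: p S_def P_def Q_def R_def X_def Y_def Z_def)
  have sums: "psd_mat (A + B)" "psd_mat (A + C)" "psd_mat (B + C)" "psd_mat (A + B + C)"
    using A B C by (auto intro!: psd_mat_add[of _ n])
  have "psd_mat ((A + B + C) ^\<^sub>K p + A ^\<^sub>K p + B ^\<^sub>K p + C ^\<^sub>K p)"
    "psd_mat ((A + B) ^\<^sub>K p + (A + C) ^\<^sub>K p + (B + C) ^\<^sub>K p)"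
    using A B C sums
    by (auto intro!: psd_mat_add[of _ "n ^ p"] psd_mat_kronecker_power[of _ n] add_carrier_mat
        simp del: kronecker_power.simps)
  moreover have "dim_row (X ^\<^sub>K p) = n ^ p" if "X \<in> carrier_mat n n" for X
    using kronecker_power_carrier[OF that] by auto
  ultimately show ?thesis
    using A B C diff by (simp add: loewner_ge_def psd_mat_def)
qed

end
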